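(* Let $G$ be a connected Lie group with a left invariant pseudo-Riemannian metric whose Ricci tensor is non-degenerate, and let $\mathfrak g$ be its metric Lie algebra. Then there is a direct sum decomposition $$\mathfrak g=\mathfrak g_1\oplus\cdots\oplus\mathfrak g_l$$ into non-zero, indecomposable, non-degenerate strong ideals, and it is unique up to the order of the factors. Distinct factors are orthogonal for both the metric and the Ricci tensor. The Ricci tensor restricted to a factor $\mathfrak g_i$ is the Ricci tensor of the restricted metric on $\mathfrak g_i$, and it is non-degenerate.
   Context: For a connected Lie group $G$ with a left invariant pseudo-Riemannian metric, $\mathfrak g$ is the (finite-dimensional real) Lie algebra of left invariant vector fields with the induced non-degenerate symmetric bilinear form $\langle\cdot,\cdot\rangle$. The Levi-Civita connection gives the bilinear product $\nabla_XY$ on $\mathfrak g$ determined by $2\langle\nabla_XY,Z\rangle=\langle[X,Y],Z\rangle-\langle[Y,Z],X\rangle+\langle[Z,X],Y\rangle$. Curvature: $R(X,Y)Z=\nabla_X\nabla_YZ-\nabla_Y\nabla_XZ-\nabla_{[X,Y]}Z$; Ricci tensor: $ric(X,Y)=\operatorname{tr}\{Z\mapsto R(Z,X)Y\}$, a symmetric bilinear form on $\mathfrak g$. For subspaces, $\nabla_{\mathfrak a}\mathfrak b$ is the linear span of all $\nabla_XY$ with $X\in\mathfrak a$, $Y\in\mathfrak b$. A subspace is non-degenerate if $\langle\cdot,\cdot\rangle$ restricts to a non-degenerate form on it. A subspace $\mathfrak h$ is a strong ideal if $\nabla_{\mathfrak g}\mathfrak h\subseteq\mathfrak h$ and $\nabla_{\mathfrak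 h}\mathfrak g\subseteq\mathfrak h$ (strong ideals are Lie ideals). A Lie algebra with a non-degenerate symmetric bilinear form is decomposable if it is a direct sum of two non-zero, non-degenerate strong ideals, and indecomposable otherwise; a non-degenerate strong ideal is regarded as such an algebra with the restricted bracket and form. *)

theory Defs
  imports "HOL-Analysis.Analysis"
begin

text \<open>
  A metric Lie algebra lives on a whole type \<open>'a\<close> of class \<open>real_vector\<close>, with bracket \<open>br\<close> and
  form \<open>ip\<close>; the dimension is finite and may be zero. The further notions take an additional
  argument \<open>V\<close>, the carrier: \<open>V = UNIV\<close> gives the notion for the algebra itself, and a subspace \<open>V\<close>
  gives the notion for \<open>V\<close> equipped with the restrictions of \<open>br\<close> and \<open>ip\<close>.
\<close>

definition nondegenerate_on :: "'a::real_vector set \<Rightarrow> ('a \<Rightarrow> 'a \<Rightarrow> real) \<Rightarrow> bool" where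
  "nondegenerate_on V f \<longleftrightarrow> (\<forall>x\<in>V. (\<forall>y\<in>V. f x y = 0) \<longrightarrow> x = 0)"

locale metric_lie_algebra =
  fixes br :: "'a::real_vector \<Rightarrow> 'a \<Rightarrow> 'a"
    and ip :: "'a \<Rightarrow> 'a \<Rightarrow> real"
  assumes finite_dim: "\<exists>B::'a set. finite B \<and> span B = UNIV"
    and bilinear_br: "bilinear br"
    and br_self: "br x x = 0"
    and jacobi: "br x (br y z) + br y (br z x) + br z (br x y) = 0"
    and bilinear_ip: "bilinear ip"
    and ip_sym: "ip x y = ip y x"
    and nondegenerate_ip: "nondegenerate_on UNIV ip"

definition levi_civita ::
    "('a::real_vector \<Rightarrow> 'a \<Rightarrow> 'a) \<Rightarrow> ('a \<Rightarrow> 'a \<Rightarrow> real) \<Rightarrow> 'a set \<Rightarrow> 'a \<Rightarrow> 'a \<Rightarrow> 'a" where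
  "levi_civita br ip V X Y =
     (THE W. W \<in> V \<and> (\<forall>Z\<in>V. 2 * ip W Z = ip (br X Y) Z - ip (br Y Z) X + ip (br Z X) Y))"

definition curvature ::
    "('a::real_vector \<Rightarrow> 'a \<Rightarrow> 'a) \<Rightarrow> ('a \<Rightarrow> 'a \<Rightarrow> real) \<Rightarrow> 'a set \<Rightarrow> 'a \<Rightarrow> 'a \<Rightarrow> 'a \<Rightarrow> 'a" where
  "curvature br ip V X Y Z =
     levi_civita br ip V X (levi_civita br ip V Y Z)
     - levi_civita br ip V Y (levi_civita br ip V X Z)
     - levi_civita br ip V (br X Y) Z"

text \<open>Trace of a linear map \<open>V \<rightarrow> V\<close>; by \<open>trace_on_eq\<close> below the chosen basis does not matter.\<close>

definition trace_on :: "'a::real_vector set \<Rightarrow> ('a \<Rightarrow> 'a) \<Rightarrow> real" where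
  "trace_on V T =
     (let B = (SOME B. independent B \<and> span B = V) in \<Sum>b\<in>B. representation B (T b) b)"

definition ricci ::
    "('a::real_vector \<Rightarrow> 'a \<Rightarrow> 'a) \<Rightarrow> ('a \<Rightarrow> 'a \<Rightarrow> real) \<Rightarrow> 'a set \<Rightarrow> 'a \<Rightarrow> 'a \<Rightarrow> real" where
  "ricci br ip V X Y = trace_on V (\<lambda>Z. curvature br ip V Z X Y)"

definition levi_civita_span ::
    "('a::real_vector \<Rightarrow> 'a \<Rightarrow> 'a) \<Rightarrow> ('a \<Rightarrow> 'a \<Rightarrow> real) \<Rightarrow> 'a set \<Rightarrow> 'a set \<Rightarrow> 'a set \<Rightarrow> 'a set" where
  "levi_civita_span br ip V A B = span {levi_civita br ip V X Y | X Y. X \<in> A \<and> Y \<in> B}"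

definition strong_ideal ::
    "('a::real_vector \<Rightarrow> 'a \<Rightarrow> 'a) \<Rightarrow> ('a \<Rightarrow> 'a \<Rightarrow> real) \<Rightarrow> 'a set \<Rightarrow> 'a set \<Rightarrow> bool" where
  "strong_ideal br ip V H \<longleftrightarrow>
     subspace H \<and> H \<subseteq> V \<and> levi_civita_span br ip V V H \<subseteq> H \<and> levi_civita_span br ip V H V \<subseteq> H"

text \<open>Internal direct sum of a list of subspaces; the empty list is a direct sum of \<open>{0}\<close>.\<close>

definition is_direct_sum :: "'a::real_vector set \<Rightarrow> 'a set list \<Rightarrow> bool" where
  "is_direct_sum V Hs \<longleftrightarrow>
     (\<forall>H\<in>set Hs. subspace H \<and> H \<subseteq> V) \<and>
     (\<forall>x\<in>V. \<exists>!xs. list_all2 (\<in>) xs Hs \<and> sum_list xs = x)"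

definition decomposable ::
    "('a::real_vector \<Rightarrow> 'a \<Rightarrow> 'a) \<Rightarrow> ('a \<Rightarrow> 'a \<Rightarrow> real) \<Rightarrow> 'a set \<Rightarrow> bool" where
  "decomposable br ip V \<longleftrightarrow>
     (\<exists>H K. is_direct_sum V [H, K] \<and>
            H \<noteq> {0} \<and> strong_ideal br ip V H \<and> nondegenerate_on H ip \<and>
            K \<noteq> {0} \<and> strong_ideal br ip V K \<and> nondegenerate_on K ip)"

definition indecomposable_decomposition ::
    "('a::real_vector \<Rightarrow> 'a \<Rightarrow> 'a) \<Rightarrow> ('a \<Rightarrow> 'a \<Rightarrow> real) \<Rightarrow> 'a set list \<Rightarrow> bool" where
  "indecomposable_decomposition br ip gs \<longleftrightarrow>
     is_direct_sum UNIV gs \<and>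
     (\<forall>H\<in>set gs. H \<noteq> {0} \<and> strong_ideal br ip UNIV H \<and> nondegenerate_on H ip \<and>
                 \<not> decomposable br ip H)"


subsection \<open>Well-definedness of the trace and of the Levi-Civita product\<close>

lemma trace_basis_independent:
  fixes B C :: "'a::real_vector set"
  assumes B: "independent B" "span B = V" "finite B"
    and C: "independent C" "span C = V" "finite C"
    and TV: "\<And>x. x \<in> V \<Longrightarrow> T x \<in> V"
    and add: "\<And>x y. x \<in> V \<Longrightarrow> y \<in> V \<Longrightarrow> T (x + y) = T x + T y"
    and scale: "\<And>c x. x \<in> V \<Longrightarrow> T (c *\<^sub>R x) = c *\<^sub>R T x"
  shows "(\<Sum>b\<in>B. representation B (T b) b) = (\<Sum>c\<in>C. representation C (T c) c)"
proof -
  have V: "subspace V" using B(2) by auto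
  have T0: "T 0 = 0" using scale[of 0 0] V by (simp add: subspace_0)
  have Tsum: "T (\<Sum>i\<in>I. f i *\<^sub>R i) = (\<Sum>i\<in>I. f i *\<^sub>R T i)"
    if "finite I" "I \<subseteq> V" for I and f :: "'a \<Rightarrow> real"
    using that
  proof (induction I rule: finite_induct)
    case empty
    then show ?case by (simp add: T0)
  next
    case (insert x F)
    then show ?case
      using add scale V by (simp add: subspace_scale subspace_sum subset_iff)
  qed
  have BV: "B \<subseteq> V" and CV: "C \<subseteq> V" using B C span_superset by blast+
  have "(\<Sum>b\<in>B. representation B (T b) b)
      = (\<Sum>b\<in>B. \<Sum>c\<in>C. representation C b c * representation B (T c) b)"
  proof (rule sum.cong[OF refl])
    fix b assume "b \<in> B"
    then have "b \<in> span C" using BV C by auto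
    then have "b = (\<Sum>c\<in>C. representation C b c *\<^sub>R c)"
      using real_vector.sum_representation_eq[OF C(1) _ C(3) order_refl] by simp
    then have "T b = (\<Sum>c\<in>C. representation C b c *\<^sub>R T c)"
      using Tsum[OF C(3) CV] by metis
    then have "representation B (T b) = representation B (\<Sum>c\<in>C. representation C b c *\<^sub>R T c)"
      by simp
    also have "\<dots> = (\<lambda>d. \<Sum>c\<in>C. representation B (representation C b c *\<^sub>R T c) d)"
      using B C CV TV V by (intro real_vector.representation_sum) (auto intro!: subspace_scale)
    finally have "representation B (T b) b
        = (\<Sum>c\<in>C. representation B (representation C b c *\<^sub>R T c) b)" by simp
    also have "\<dots> = (\<Sum>c\<in>C. representation C b c * representation B (T c) b)"
      using B CV TV by (intro sum.cong refl) (subst real_vector.representation_scale; auto)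
    finally show "representation B (T b) b = (\<Sum>c\<in>C. representation C b c * representation B (T c) b)" .
  qed
  also have "\<dots> = (\<Sum>c\<in>C. \<Sum>b\<in>B. representation C b c * representation B (T c) b)"
    by (rule sum.swap)
  also have "\<dots> = (\<Sum>c\<in>C. representation C (T c) c)"
  proof (rule sum.cong[OF refl])
    fix c assume "c \<in> C"
    then have "T c \<in> span B" using CV TV B by auto
    then have "T c = (\<Sum>b\<in>B. representation B (T c) b *\<^sub>R b)"
      using real_vector.sum_representation_eq[OF B(1) _ B(3) order_refl] by simp
    then have "representation C (T c) = representation C (\<Sum>b\<in>B. representation B (T c) b *\<^sub>R b)"
      by simp
    also have "\<dots> = (\<lambda>d. \<Sum>b\<in>B. representation C (representation B (T c) b *\<^sub>R b) d)"
      using C BV V by (intro real_vector.representation_sum) (auto intro!: subspace_scale)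
    finally have "representation C (T c) c
        = (\<Sum>b\<in>B. representation C (representation B (T c) b *\<^sub>R b) c)" by simp
    also have "\<dots> = (\<Sum>b\<in>B. representation C b c * representation B (T c) b)"
      using C BV by (intro sum.cong refl) (subst real_vector.representation_scale; auto)
    finally show "(\<Sum>b\<in>B. representation C b c * representation B (T c) b)
        = representation C (T c) c" by simp
  qed
  finally show ?thesis .
qed

lemma trace_on_eq:
  fixes B :: "'a::real_vector set"
  assumes B: "independent B" "span B = V" "finite B"
    and TV: "\<And>x. x \<in> V \<Longrightarrow> T x \<in> V"
    and add: "\<And>x y. x \<in> V \<Longrightarrow> y \<in> V \<Longrightarrow> T (x + y) = T x + T y"
    and scale: "\<And>c x. x \<in> V \<Longrightarrow> T (c *\<^sub>R x) = c *\<^sub>R T x"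
  shows "trace_on V T = (\<Sum>b\<in>B. representation B (T b) b)"
proof -
  define C where "C = (SOME C. independent C \<and> span C = V)"
  have C: "independent C" "span C = V"
    using someI[of "\<lambda>C. independent C \<and> span C = V" B] B unfolding C_def by auto
  have "finite C"
    using real_vector.independent_span_bound[OF B(3) C(1)] B(2) C(2) span_superset by blast
  then show ?thesis
    using trace_basis_independent[OF C _ B TV add scale]
    unfolding trace_on_def C_def[symmetric] Let_def by simp
qed

context metric_lie_algebra
begin

lemma riesz:
  assumes V: "subspace V" and nd: "nondegenerate_on V ip"
    and f: "linear f"
  shows "\<exists>!w. w \<in> V \<and> (\<forall>z\<in>V. ip w z = f z)"
proof (rule ex_ex1I)
  obtain C where C: "independent C" "span C = V"
    using real_vector.maximal_independent_subset[of V] V by (metis span_minimal subset_antisym)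
  obtain B :: "'a set" where "finite B" "span B = UNIV" using finite_dim by blast
  then have fC: "finite C" using real_vector.independent_span_bound[of B C] C by auto
  have CV: "C \<subseteq> V" using C span_superset by blast
  define \<Phi> where "\<Phi> w = (\<Sum>c\<in>C. ip w c *\<^sub>R c)" for w
  have lin: "linear \<Phi>"
    by (rule linearI)
      (simp_all add: \<Phi>_def bilinear_ladd[OF bilinear_ip] bilinear_lmul[OF bilinear_ip]
        scaleR_left_distrib sum.distrib scaleR_sum_right)
  have lip: "linear (ip w)" for w using bilinear_ip by (simp add: bilinear_def)
  have coef: "\<forall>c\<in>C. g c = 0" if "(\<Sum>c\<in>C. g c *\<^sub>R c) = 0" for g :: "'a \<Rightarrow> real"
    using that C(1) fC by (metis dependent_finite)
  have ext: "ip w z = h z" if "linear h" "\<forall>c\<in>C. ip w c = h c" "z \<in> V" for w z and h :: "'a \<Rightarrow> real"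
    using linear_eq_on[OF lip that(1), of z C w] that C by auto
  have inj: "inj_on \<Phi> V"
  proof -
    have "w = 0" if "w \<in> V" "\<Phi> w = 0" for w
    proof -
      have "\<forall>c\<in>C. ip w c = 0"
        using coef[of "ip w"] that(2) by (simp add: \<Phi>_def)
      then have "\<forall>z\<in>V. ip w z = 0" using ext[of "\<lambda>_. 0" w] by (simp add: linear_iff)
      then show ?thesis using nd that(1) by (auto simp: nondegenerate_on_def)
    qed
    then show ?thesis
      using linear_injective_on_subspace_0[OF lin V] by blast
  qed
  have ind: "independent (\<Phi> ` C)"
    using linear_independent_injective_image[OF lin C(1)] inj C(2) by simp
  have sub: "\<Phi> ` C \<subseteq> span C"
    unfolding \<Phi>_def by (intro image_subsetI span_sum span_scale span_base)
  have card: "card (\<Phi> ` C) = card C"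
    using inj CV by (intro card_image) (rule inj_on_subset)
  have "span C \<subseteq> span (\<Phi> ` C)"
  proof (rule ccontr)
    assume "\<not> span C \<subseteq> span (\<Phi> ` C)"
    then obtain v where v: "v \<in> span C" "v \<notin> span (\<Phi> ` C)" by blast
    then have "independent (insert v (\<Phi> ` C))" using ind by (simp add: independent_insertI)
    then have "card (insert v (\<Phi> ` C)) \<le> card C"
      using real_vector.independent_span_bound[OF fC] v(1) sub by blast
    moreover have "v \<notin> \<Phi> ` C" using v(2) span_base[of v "\<Phi> ` C"] by satx
    ultimately show False using card fC by simp
  qed
  then have "V \<subseteq> \<Phi> ` V"
    using C(2) linear_span_image[OF lin, of C] by simp
  moreover have "(\<Sum>c\<in>C. f c *\<^sub>R c) \<in> V"
    using V CV by (auto intro!: subspace_sum subspace_scale)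
  ultimately have "(\<Sum>c\<in>C. f c *\<^sub>R c) \<in> \<Phi> ` V" by (rule subsetD)
  then obtain w where w: "w \<in> V" "\<Phi> w = (\<Sum>c\<in>C. f c *\<^sub>R c)" by (metis imageE)
  have "(\<Sum>c\<in>C. (ip w c - f c) *\<^sub>R c) = 0"
    using w(2) by (simp add: \<Phi>_def scaleR_left_diff_distrib sum_subtractf)
  from coef[OF this] have "\<forall>c\<in>C. ip w c = f c" by simp
  then show "\<exists>w. w \<in> V \<and> (\<forall>z\<in>V. ip w z = f z)" using ext[OF f] w(1) by metis
next
  fix w w' assume w: "w \<in> V \<and> (\<forall>z\<in>V. ip w z = f z)" and w': "w' \<in> V \<and> (\<forall>z\<in>V. ip w' z = f z)"
  then have "w - w' \<in> V" "\<forall>z\<in>V. ip (w - w') z = 0"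
    using V by (auto simp: subspace_diff bilinear_lsub[OF bilinear_ip])
  then have "w - w' = 0" using nd unfolding nondegenerate_on_def by blast
  then show "w = w'" by simp
qed

lemma levi_civita:
  assumes "subspace V" "nondegenerate_on V ip"
  shows "levi_civita br ip V X Y \<in> V"
    and "Z \<in> V \<Longrightarrow> 2 * ip (levi_civita br ip V X Y) Z = ip (br X Y) Z - ip (br Y Z) X + ip (br Z X) Y"
proof -
  let ?f = "\<lambda>Z. (ip (br X Y) Z - ip (br Y Z) X + ip (br Z X) Y) / 2"
  have "linear ?f"
    by (rule linearI)
      (simp_all add: field_simps bilinear_ladd[OF bilinear_ip] bilinear_lmul[OF bilinear_ip]
        bilinear_radd[OF bilinear_ip] bilinear_rmul[OF bilinear_ip] bilinear_ladd[OF bilinear_br]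
        bilinear_lmul[OF bilinear_br] bilinear_radd[OF bilinear_br] bilinear_rmul[OF bilinear_br])
  moreover have "ip W Z = ?f Z \<longleftrightarrow> 2 * ip W Z = ip (br X Y) Z - ip (br Y Z) X + ip (br Z X) Y" for W Z
    by auto
  ultimately have "\<exists>!W. W \<in> V \<and> (\<forall>Z\<in>V. 2 * ip W Z = ip (br X Y) Z - ip (br Y Z) X + ip (br Z X) Y)"
    using riesz[OF assms, of ?f] by presburger
  note * = theI'[OF this, folded levi_civita_def]
  show "levi_civita br ip V X Y \<in> V"
    and "Z \<in> V \<Longrightarrow> 2 * ip (levi_civita br ip V X Y) Z = ip (br X Y) Z - ip (br Y Z) X + ip (br Z X) Y"
    using * by simp_all
qed

end

end

(* Every Y with nabla Y = 0 satisfies ric(., Y) = 0, so a non-degenerate Ricci tensor leaves no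
   such Y except 0; as nabla is skew-symmetric, this says that the products nabla_X Y span the
   algebra. For complementary strong ideals H and K the mixed products vanish, so H is spanned by
   the products of its own elements. This forces H and K to be orthogonal, and it makes every
   strong summand G split as the sum of its intersections with H and K; an indecomposable G
   therefore lies in H or in K, which gives uniqueness. A decomposition into as many factors as
   possible exists because the number of factors is bounded by the dimension. *)

theory Submission
  imports Defs
begin

subsection \<open>Direct sums of lists of subspaces\<close>

text \<open>\<open>decomposable\<close> and \<open>indecomposable_decomposition\<close> do not ask
  the summands to be orthogonal. Orthogonality must therefore be derived before indecomposability of
  \<open>G\<close> can be exploited: it is what makes the intersections of \<open>G\<close> with
  \<open>H\<close> and with \<open>K\<close> non-degenerate, hence admissible as summands of
  \<open>G\<close>. The form may be indefinite, so a subspace can meet its orthogonal space;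
  complements are therefore never taken as orthogonal spaces but always come from a given direct
  sum, for a list of factors as the sum of all factors but one (\<open>other_factors\<close>). This
  reduces every statement on lists to two complementary strong ideals. A further point is the side
  on which the Ricci tensor is tested: its non-degeneracy is stated for the first argument, while
  vectors with vanishing derivative are killed in the second; a dimension argument carries one over
  to the other.\<close>

lemma is_direct_sum_iff:
  "is_direct_sum V Hs \<longleftrightarrow>
     (\<forall>k<length Hs. subspace (Hs ! k) \<and> Hs ! k \<subseteq> V) \<and>
     (\<forall>x\<in>V. \<exists>f. (\<forall>k<length Hs. f k \<in> Hs ! k) \<and> x = (\<Sum>k<length Hs. f k)) \<and>
     (\<forall>f. (\<forall>k<length Hs. f k \<in> Hs ! k) \<longrightarrow> (\<Sum>k<length Hs. f k) = 0 \<longrightarrow>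
        (\<forall>k<length Hs. f k = 0))"
  (is "?L \<longleftrightarrow> ?S \<and> ?E \<and> ?U")
proof -
  let ?n = "length Hs"
  have S: "(\<forall>H\<in>set Hs. subspace H \<and> H \<subseteq> V) \<longleftrightarrow> ?S"
    by (metis in_set_conv_nth)
  have sum_nth: "sum_list xs = (\<Sum>k<?n. xs ! k)" if "length xs = ?n" for xs :: "'a list"
    using that by (simp add: sum_list_sum_nth atLeast0LessThan)
  have sum_map: "sum_list (map f [0..<?n]) = (\<Sum>k<?n. f k)" for f :: "nat \<Rightarrow> 'a"
    by (simp add: sum_nth)
  \<comment> \<open>Lists with one entry in each factor become functions on indices. Such a function
    is arbitrary from \<open>?n\<close> on, so the new criterion claims uniqueness only below
    \<open>?n\<close>, and only for sums equal to zero; differences recover the general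
    case.\<close>
  have E: "(\<exists>xs. list_all2 (\<in>) xs Hs \<and> sum_list xs = x) \<longleftrightarrow>
      (\<exists>f. (\<forall>k<?n. f k \<in> Hs ! k) \<and> x = (\<Sum>k<?n. f k))" for x
  proof
    assume "\<exists>xs. list_all2 (\<in>) xs Hs \<and> sum_list xs = x"
    then obtain xs where "list_all2 (\<in>) xs Hs" "sum_list xs = x" by blast
    then show "\<exists>f. (\<forall>k<?n. f k \<in> Hs ! k) \<and> x = (\<Sum>k<?n. f k)"
      by (intro exI[of _ "\<lambda>k. xs ! k"]) (auto simp: list_all2_conv_all_nth sum_nth)
  next
    assume "\<exists>f. (\<forall>k<?n. f k \<in> Hs ! k) \<and> x = (\<Sum>k<?n. f k)"
    then obtain f where "\<forall>k<?n. f k \<in> Hs ! k" "x = (\<Sum>k<?n. f k)" by blast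
    then show "\<exists>xs. list_all2 (\<in>) xs Hs \<and> sum_list xs = x"
      by (intro exI[of _ "map f [0..<?n]"]) (simp add: list_all2_conv_all_nth sum_map)
  qed
  show ?thesis
  proof
    assume L: ?L
    then have sub: ?S using S by (auto simp: is_direct_sum_def)
    have "f k = 0" if f: "\<forall>k<?n. f k \<in> Hs ! k" "(\<Sum>k<?n. f k) = 0" and k: "k < ?n" for f k
    proof -
      \<comment> \<open>\<open>V\<close> is not assumed to be a subspace; \<open>0\<close> belongs
        to it because some factor exists, \<open>k\<close> being an index.\<close>
      have "Hs ! k \<subseteq> V" "subspace (Hs ! k)" using sub k by auto
      then have "0 \<in> V" by (auto dest: subspace_0)
      then have "\<exists>!xs. list_all2 (\<in>) xs Hs \<and> sum_list xs = 0" using L by (simp add: is_direct_sum_def)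
      moreover have "list_all2 (\<in>) (map f [0..<?n]) Hs \<and> sum_list (map f [0..<?n]) = 0"
        using f by (simp add: list_all2_conv_all_nth sum_map)
      moreover have "list_all2 (\<in>) (map (\<lambda>_. 0) [0..<?n]) Hs \<and>
          sum_list (map (\<lambda>_. 0) [0..<?n]) = (0::'a)"
        using sub by (simp add: list_all2_conv_all_nth subspace_0)
      ultimately have "map f [0..<?n] = map (\<lambda>_. 0) [0..<?n]" by blast
      then show ?thesis using k by simp
    qed
    then have ?U by blast
    moreover have ?E
    proof
      fix x assume "x \<in> V"
      then have "\<exists>xs. list_all2 (\<in>) xs Hs \<and> sum_list xs = x"
        using L unfolding is_direct_sum_def by (meson ex1_implies_ex)
      then show "\<exists>f. (\<forall>k<?n. f k \<in> Hs ! k) \<and> x = (\<Sum>k<?n. f k)" unfolding E .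
    qed
    ultimately show "?S \<and> ?E \<and> ?U" using sub by simp
  next
    assume R: "?S \<and> ?E \<and> ?U"
    then have sub: ?S and uniq: ?U by simp_all
    have "xs = ys" if xs: "list_all2 (\<in>) xs Hs" and ys: "list_all2 (\<in>) ys Hs"
      and eq: "sum_list xs = sum_list ys" for xs ys
    proof -
      have len: "length xs = ?n" "length ys = ?n" using xs ys by (auto dest: list_all2_lengthD)
      have "\<forall>k<?n. xs ! k - ys ! k \<in> Hs ! k"
        using xs ys sub by (simp add: list_all2_conv_all_nth subspace_diff)
      moreover have "(\<Sum>k<?n. xs ! k - ys ! k) = 0"
        using eq len by (simp add: sum_nth sum_subtractf)
      ultimately have "\<forall>k<?n. xs ! k - ys ! k = 0"
        using uniq[rule_format, of "\<lambda>k. xs ! k - ys ! k"] by blast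
      then show ?thesis using len by (simp add: list_eq_iff_nth_eq)
    qed
    moreover have "\<exists>xs. list_all2 (\<in>) xs Hs \<and> sum_list xs = x" if "x \<in> V" for x
      unfolding E using R that by simp
    ultimately have "\<forall>x\<in>V. \<exists>!xs. list_all2 (\<in>) xs Hs \<and> sum_list xs = x"
      by (intro ballI ex_ex1I) simp_all
    with S[THEN iffD2, OF sub] show ?L unfolding is_direct_sum_def by (rule conjI)
  qed
qed

lemma is_direct_sum_subspace: "is_direct_sum V Hs \<Longrightarrow> k < length Hs \<Longrightarrow> subspace (Hs ! k)"
  by (simp add: is_direct_sum_def)

lemma is_direct_sum_obtain:
  assumes "is_direct_sum V Hs" "x \<in> V"
  obtains f where "\<And>k. k < length Hs \<Longrightarrow> f k \<in> Hs ! k" "x = (\<Sum>k<length Hs. f k)"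
  using assms(1)[unfolded is_direct_sum_iff, THEN conjunct2, THEN conjunct1] assms(2) by metis

lemma is_direct_sum_zero:
  assumes "is_direct_sum V Hs" "\<And>k. k < length Hs \<Longrightarrow> f k \<in> Hs ! k"
    and "(\<Sum>k<length Hs. f k) = 0" "k < length Hs"
  shows "f k = 0"
  using assms(1)[unfolded is_direct_sum_iff, THEN conjunct2, THEN conjunct2, rule_format, of f k] assms
  by simp

lemma is_direct_sum_pair_iff:
  "is_direct_sum V [A, B] \<longleftrightarrow>
     subspace A \<and> subspace B \<and> A \<subseteq> V \<and> B \<subseteq> V \<and> A \<inter> B = {0} \<and> (\<forall>x\<in>V. \<exists>a\<in>A. \<exists>b\<in>B. x = a + b)"
  (is "?L \<longleftrightarrow> ?R")
proof -
  have all2: "list_all2 (\<in>) xs [A, B] \<longleftrightarrow> (\<exists>a b. xs = [a, b] \<and> a \<in> A \<and> b \<in> B)" for xs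
    by (auto simp: list_all2_Cons2)
  have def: "?L \<longleftrightarrow> subspace A \<and> A \<subseteq> V \<and> subspace B \<and> B \<subseteq> V \<and>
      (\<forall>x\<in>V. \<exists>!xs. (\<exists>a b. xs = [a, b] \<and> a \<in> A \<and> b \<in> B) \<and> sum_list xs = x)"
    unfolding is_direct_sum_def all2 by simp
  show ?thesis
  proof
    assume ?L
    then have sub: "subspace A" "A \<subseteq> V" "subspace B" "B \<subseteq> V"
      and ex1: "\<And>x. x \<in> V \<Longrightarrow> \<exists>!xs. (\<exists>a b. xs = [a, b] \<and> a \<in> A \<and> b \<in> B) \<and> sum_list xs = x"
      unfolding def by simp_all
    have "x = 0" if x: "x \<in> A" "x \<in> B" for x
    proof -
      have "\<exists>a b. [x, 0] = [a, b] \<and> a \<in> A \<and> b \<in> B" "\<exists>a b. [0, x] = [a, b] \<and> a \<in> A \<and> b \<in> B"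
        "sum_list [x, 0] = x" "sum_list [0, x] = x"
        using x sub by (simp_all add: subspace_0)
      then have "[x, 0] = [0, x]" using ex1[of x] x sub by (metis (lifting) subsetD)
      then show ?thesis by simp
    qed
    then have "A \<inter> B = {0}" using sub by (auto intro: subspace_0)
    moreover have "\<exists>a\<in>A. \<exists>b\<in>B. x = a + b" if "x \<in> V" for x
    proof -
      obtain xs where "(\<exists>a b. xs = [a, b] \<and> a \<in> A \<and> b \<in> B) \<and> sum_list xs = x"
        using ex1_implies_ex[OF ex1[OF \<open>x \<in> V\<close>]] by (elim exE)
      then obtain a b where "a \<in> A" "b \<in> B" "sum_list [a, b] = x" by (elim conjE exE) simp
      then show ?thesis by (intro bexI[of _ a] bexI[of _ b]) simp_all
    qed
    ultimately show ?R using sub by simp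
  next
    assume R: ?R
    have "\<exists>!xs. (\<exists>a b. xs = [a, b] \<and> a \<in> A \<and> b \<in> B) \<and> sum_list xs = x" if "x \<in> V" for x
    proof (rule ex_ex1I)
      obtain a b where "a \<in> A" "b \<in> B" "x = a + b" using R \<open>x \<in> V\<close> by blast
      then show "\<exists>xs. (\<exists>a b. xs = [a, b] \<and> a \<in> A \<and> b \<in> B) \<and> sum_list xs = x"
        by (intro exI[of _ "[a, b]"]) simp
    next
      fix xs ys
      assume "(\<exists>a b. xs = [a, b] \<and> a \<in> A \<and> b \<in> B) \<and> sum_list xs = x"
        "(\<exists>a b. ys = [a, b] \<and> a \<in> A \<and> b \<in> B) \<and> sum_list ys = x"
      then obtain a b a' b' where *: "xs = [a, b]" "ys = [a', b']" "a \<in> A" "a' \<in> A" "b \<in> B" "b' \<in> B"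
        "a + b = a' + b'" by auto
      then have "a - a' = b' - b" by (simp add: algebra_simps)
      moreover have "a - a' \<in> A" "b' - b \<in> B" using * R by (simp_all add: subspace_diff)
      ultimately have "a - a' \<in> A \<inter> B" by simp
      then have "a - a' = 0" using R by blast
      then have "a = a'" by simp
      moreover from this have "b = b'" using *(7) by simp
      ultimately show "xs = ys" using *(1,2) by simp
    qed
    moreover have "subspace A" "A \<subseteq> V" "subspace B" "B \<subseteq> V" using R by simp_all
    ultimately show ?L unfolding def by (intro conjI ballI)
  qed
qed

lemma is_direct_sum_nth_Int:
  assumes ds: "is_direct_sum V Hs" and ij: "i < length Hs" "j < length Hs" "i \<noteq> j"
  shows "Hs ! i \<inter> Hs ! j = {0}"
proof -
  have sub: "\<forall>k<length Hs. subspace (Hs ! k)" using ds by (simp add: is_direct_sum_subspace)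
  have "x = 0" if x: "x \<in> Hs ! i" "x \<in> Hs ! j" for x
  proof -
    let ?f = "\<lambda>k. (if k = i then x else 0) - (if k = j then x else 0)"
    have "\<forall>k<length Hs. ?f k \<in> Hs ! k"
      using x sub by (auto simp: subspace_0 subspace_neg)
    moreover have "(\<Sum>k<length Hs. ?f k) = 0"
      using ij by (simp add: sum_subtractf)
    ultimately have "?f i = 0" using is_direct_sum_zero[OF ds, of ?f i] ij(1) by blast
    then show ?thesis using ij(3) by simp
  qed
  then show ?thesis using sub ij by (auto intro: subspace_0)
qed

text \<open>The step that contradicts maximality in the existence proof: splitting one factor makes
  the list longer by one. \<open>A\<close> goes to the front, so that every old index moves up by
  exactly one and \<open>B\<close> takes the place of the split factor.\<close>

lemma is_direct_sum_refine:
  assumes ds: "is_direct_sum V Hs" and i: "i < length Hs" and AB: "is_direct_sum (Hs ! i) [A, B]"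
  shows "is_direct_sum V (A # Hs[i := B])"
proof -
  let ?n = "length Hs"
  have sub: "\<forall>k<?n. subspace (Hs ! k) \<and> Hs ! k \<subseteq> V"
    using ds by (simp add: is_direct_sum_def)
  have AB': "subspace A" "subspace B" "A \<subseteq> Hs ! i" "B \<subseteq> Hs ! i" "A \<inter> B = {0}"
    "\<forall>x\<in>Hs ! i. \<exists>a\<in>A. \<exists>b\<in>B. x = a + b"
    using AB unfolding is_direct_sum_pair_iff by simp_all
  have AB0: "a = 0 \<and> b = 0" if "a \<in> A" "b \<in> B" "a + b = 0" for a b
  proof -
    have "a = - b" using that by (simp add: eq_neg_iff_add_eq_0)
    then have "a \<in> A \<inter> B" using that \<open>subspace B\<close> by (simp add: subspace_neg)
    then show ?thesis using AB'(5) that by simp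
  qed
  have nth0: "(A # Hs[i := B]) ! 0 = A" by simp
  have nthS: "(A # Hs[i := B]) ! Suc k = (if k = i then B else Hs ! k)" if "k < ?n" for k
    using that by simp
  have all: "(\<forall>k<Suc ?n. P k) \<longleftrightarrow> P 0 \<and> (\<forall>k<?n. P (Suc k))" for P
    using less_Suc_eq_0_disj by auto
  have mem: "(\<forall>k<Suc ?n. f k \<in> (A # Hs[i := B]) ! k) \<longleftrightarrow>
      f 0 \<in> A \<and> (\<forall>k<?n. f (Suc k) \<in> (if k = i then B else Hs ! k))" for f
    unfolding all nth0 using nthS by simp
  have len: "length (A # Hs[i := B]) = Suc ?n" by simp
  \<comment> \<open>The entry at \<open>0\<close> is folded back into position \<open>i\<close>,
    which turns a sum over the refined list into a sum over the old list with the component in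
    \<open>Hs ! i\<close> equal to the sum of its parts in \<open>A\<close> and
    \<open>B\<close>.\<close>
  have sum_upd: "(\<Sum>k<Suc ?n. f k) = (\<Sum>k<?n. (if k = i then f 0 else 0) + f (Suc k))"
    for f :: "nat \<Rightarrow> 'a"
    using i by (simp add: sum.lessThan_Suc_shift sum.distrib del: sum.lessThan_Suc)
  show ?thesis
    unfolding is_direct_sum_iff len
  proof (intro conjI ballI allI impI)
    fix k assume "k < Suc ?n"
    then have "subspace ((A # Hs[i := B]) ! k) \<and> (A # Hs[i := B]) ! k \<subseteq> V"
      using sub AB'(1-4) i by (cases k) (auto simp: nth_list_update)
    then show "subspace ((A # Hs[i := B]) ! k)" "(A # Hs[i := B]) ! k \<subseteq> V" by simp_all
  next
    fix x assume "x \<in> V"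
    then obtain f where f: "\<And>k. k < ?n \<Longrightarrow> f k \<in> Hs ! k" "x = (\<Sum>k<?n. f k)"
      using is_direct_sum_obtain[OF ds] by blast
    then obtain a b where ab: "a \<in> A" "b \<in> B" "f i = a + b" using AB'(6) i by blast
    define g where "g k = (case k of 0 \<Rightarrow> a | Suc m \<Rightarrow> if m = i then b else f m)" for k
    have "(\<Sum>k<?n. f k) = (\<Sum>k<?n. (if k = i then g 0 else 0) + g (Suc k))"
      using ab(3) by (intro sum.cong) (auto simp: g_def)
    then have "x = (\<Sum>k<Suc ?n. g k)" using f(2) sum_upd[of g] by simp
    moreover have "\<forall>k<Suc ?n. g k \<in> (A # Hs[i := B]) ! k"
      unfolding mem using ab f by (simp add: g_def)
    ultimately show "\<exists>f. (\<forall>k<Suc ?n. f k \<in> (A # Hs[i := B]) ! k) \<and> x = (\<Sum>k<Suc ?n. f k)" by blast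
  next
    fix f k
    assume f: "\<forall>k<Suc ?n. f k \<in> (A # Hs[i := B]) ! k" "(\<Sum>k<Suc ?n. f k) = 0" and k: "k < Suc ?n"
    define g where "g k = (if k = i then f 0 else 0) + f (Suc k)" for k
    have f': "f 0 \<in> A" "\<forall>k<?n. f (Suc k) \<in> (if k = i then B else Hs ! k)" using f(1) unfolding mem by auto
    have "\<forall>k<?n. g k \<in> Hs ! k"
    proof (intro allI impI)
      fix k assume k: "k < ?n"
      show "g k \<in> Hs ! k"
      proof (cases "k = i")
        case True
        then have "f 0 \<in> Hs ! i" "f (Suc i) \<in> Hs ! i"
            using f'(1) f'(2)[rule_format, OF i] AB'(3,4) by auto
        then show ?thesis using True sub k by (simp add: g_def subspace_add)
      next
        case False
        then show ?thesis using f'(2) k by (auto simp: g_def)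
      qed
    qed
    moreover have "(\<Sum>k<?n. g k) = 0" using f(2) sum_upd[of f] by (simp add: g_def)
    ultimately have g0: "\<forall>k<?n. g k = 0" using is_direct_sum_zero[OF ds, of g] by blast
    have "f (Suc i) \<in> B" using f'(2) i by auto
    moreover have "f 0 + f (Suc i) = 0" using g0 i by (auto simp: g_def)
    ultimately have fi: "f 0 = 0" "f (Suc i) = 0" using AB0 f'(1) by blast+
    show "f k = 0"
    proof (cases k)
      case 0
      then show ?thesis using fi by simp
    next
      case (Suc m)
      then show ?thesis using g0 fi k by (cases "m = i") (auto simp: g_def)
    qed
  qed
qed

text \<open>One non-zero vector from each factor gives a linearly independent family, because zero
  has only the trivial decomposition.\<close>

lemma is_direct_sum_length_bound:
  fixes Hs :: "'a::real_vector set list" and B :: "'a set"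
  assumes ds: "is_direct_sum V Hs" and B: "finite B" "span B = UNIV"
    and nz: "\<forall>H\<in>set Hs. H \<noteq> {0}"
  shows "length Hs \<le> card B"
proof -
  let ?n = "length Hs"
  have sub: "\<forall>k<?n. subspace (Hs ! k)" using ds by (simp add: is_direct_sum_subspace)
  have "\<exists>x\<in>Hs ! k. x \<noteq> 0" if "k < ?n" for k
  proof -
    have "Hs ! k \<noteq> {0}" "0 \<in> Hs ! k" using that sub nz by (auto intro: subspace_0)
    then show ?thesis by blast
  qed
  then obtain b where b: "\<And>k. k < ?n \<Longrightarrow> b k \<in> Hs ! k \<and> b k \<noteq> 0" by metis
  have inj: "inj_on b {..<?n}"
  proof (rule inj_onI)
    fix k l assume kl: "k \<in> {..<?n}" "l \<in> {..<?n}" "b k = b l"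
    show "k = l"
    proof (rule ccontr)
      assume "k \<noteq> l"
      then have "Hs ! k \<inter> Hs ! l = {0}" using is_direct_sum_nth_Int[OF ds] kl by simp
      then show False using b[of k] b[of l] kl by auto
    qed
  qed
  have "independent (b ` {..<?n})"
  proof (rule real_vector.independent_if_scalars_zero)
    fix u :: "'a \<Rightarrow> real" and x
    assume "(\<Sum>x\<in>b ` {..<?n}. u x *\<^sub>R x) = 0" and x: "x \<in> b ` {..<?n}"
    then have "(\<Sum>k<?n. u (b k) *\<^sub>R b k) = 0" using inj by (simp add: sum.reindex)
    moreover have "\<forall>k<?n. u (b k) *\<^sub>R b k \<in> Hs ! k" using b sub by (simp add: subspace_scale)
    ultimately have "\<forall>k<?n. u (b k) *\<^sub>R b k = 0"
      using is_direct_sum_zero[OF ds, of "\<lambda>k. u (b k) *\<^sub>R b k"] by blast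
    then show "u x = 0" using b x by auto
  qed simp
  then have "card (b ` {..<?n}) \<le> card B"
    using real_vector.independent_span_bound[OF B(1), of "b ` {..<?n}"] B(2) by simp
  then show ?thesis using inj by (simp add: card_image)
qed

subsection \<open>Trace on an invariant subspace\<close>

text \<open>Extend a basis \<open>C\<close> of \<open>H\<close> to a basis \<open>D\<close> of the
  whole space. Every \<open>T b\<close> lies in the span of \<open>C\<close>, so the basis vectors
  outside \<open>C\<close> contribute nothing to the trace.\<close>

lemma trace_on_range:
  fixes T :: "'a::real_vector \<Rightarrow> 'a"
  assumes B: "finite B" "span B = (UNIV :: 'a set)" and H: "subspace H"
    and T: "linear T" "range T \<subseteq> H"
  shows "trace_on UNIV T = trace_on H T"
proof -
  obtain C where C: "independent C" "span C = H"
    using real_vector.maximal_independent_subset[of H] H by (metis span_minimal subset_antisym)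
  obtain D where D: "C \<subseteq> D" "independent D" "span D = UNIV"
    using real_vector.maximal_independent_subset_extend[of C UNIV] C(1)
    by (metis subset_UNIV top.extremum_unique)
  have fD: "finite D" using real_vector.independent_span_bound[OF B(1) D(2)] B(2) by simp
  then have fC: "finite C" using D(1) by (rule rev_finite_subset)
  have TC: "T x \<in> span C" for x using T(2) C(2) by blast
  have "trace_on UNIV T = (\<Sum>b\<in>D. representation D (T b) b)"
    using T(1) by (intro trace_on_eq D fD) (auto simp: linear_add linear_scale)
  also have "\<dots> = (\<Sum>b\<in>D. representation C (T b) b)"
    using real_vector.representation_extend[OF D(2) TC D(1)] by simp
  also have "\<dots> = (\<Sum>b\<in>C. representation C (T b) b)"
    using fD D(1) real_vector.representation_ne_zero by (intro sum.mono_neutral_right) auto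
  also have "\<dots> = trace_on H T"
    using T C by (intro trace_on_eq[symmetric] fC) (auto simp: linear_add linear_scale)
  finally show ?thesis .
qed

subsection \<open>The Levi-Civita product and strong ideals\<close>

lemma strong_ideal_iff:
  "strong_ideal br ip V H \<longleftrightarrow> subspace H \<and> H \<subseteq> V \<and>
     (\<forall>X\<in>V. \<forall>Y\<in>H. levi_civita br ip V X Y \<in> H \<and> levi_civita br ip V Y X \<in> H)"
proof -
  have *: "levi_civita_span br ip V A B \<subseteq> H \<longleftrightarrow> (\<forall>X\<in>A. \<forall>Y\<in>B. levi_civita br ip V X Y \<in> H)"
    if "subspace H" for A B
  proof -
    have "span S \<subseteq> H \<longleftrightarrow> S \<subseteq> H" for S
      using span_minimal[OF _ that] span_superset[of S] by (meson order_trans)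
    then show ?thesis unfolding levi_civita_span_def by fastforce
  qed
  show ?thesis
  proof (cases "subspace H")
    case True
    show ?thesis unfolding strong_ideal_def *[OF True] by blast
  qed (simp add: strong_ideal_def)
qed

context metric_lie_algebra
begin

abbreviation nab :: "'a \<Rightarrow> 'a \<Rightarrow> 'a" where "nab \<equiv> levi_civita br ip UNIV"

lemmas ip_simps =
  bilinear_ladd[OF bilinear_ip] bilinear_radd[OF bilinear_ip] bilinear_lmul[OF bilinear_ip]
  bilinear_rmul[OF bilinear_ip] bilinear_lsub[OF bilinear_ip] bilinear_rsub[OF bilinear_ip]
  bilinear_lzero[OF bilinear_ip] bilinear_rzero[OF bilinear_ip]

lemmas br_simps =
  bilinear_ladd[OF bilinear_br] bilinear_radd[OF bilinear_br] bilinear_lmul[OF bilinear_br]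
  bilinear_rmul[OF bilinear_br] bilinear_lsub[OF bilinear_br] bilinear_rsub[OF bilinear_br]

lemma br_antisym: "br y x = - br x y"
proof -
  have "br (x + y) (x + y) = 0" by (rule br_self)
  then have "br x y + br y x = 0" by (simp add: br_simps br_self[of x] br_self[of y] add.commute)
  then show ?thesis by (simp add: eq_neg_iff_add_eq_0 add.commute)
qed

lemma ip_eqI:
  assumes V: "subspace V" "nondegenerate_on V ip" and "w \<in> V" "w' \<in> V"
    and "\<And>z. z \<in> V \<Longrightarrow> ip w z = ip w' z"
  shows "w = w'"
proof -
  have "w - w' \<in> V" "\<forall>z\<in>V. ip (w - w') z = 0"
    using assms by (auto simp: subspace_diff ip_simps)
  then have "w - w' = 0" using V(2) unfolding nondegenerate_on_def by blast
  then show ?thesis by simp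
qed

lemma koszul: "2 * ip (nab X Y) Z = ip (br X Y) Z - ip (br Y Z) X + ip (br Z X) Y"
  by (rule levi_civita(2)[OF subspace_UNIV nondegenerate_ip UNIV_I])

lemma nab_eqI: "(\<And>Z. ip W Z = ip (nab X Y) Z) \<Longrightarrow> nab X Y = W"
  by (rule ip_eqI[OF subspace_UNIV nondegenerate_ip]) simp_all

text \<open>The product is defined by a description (\<open>THE\<close>), so its linearity is read
  off the right-hand side of the Koszul formula, tested against all \<open>Z\<close>.\<close>

lemma bilinear_nab: "bilinear nab"
proof -
  have half: "ip (nab X Y) Z = (ip (br X Y) Z - ip (br Y Z) X + ip (br Z X) Y) / 2" for X Y Z
    using koszul[of X Y Z] by simp
  show ?thesis
    unfolding bilinear_def
    by (intro conjI allI linearI; rule nab_eqI) (simp_all add: half ip_simps br_simps field_simps)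
qed

lemmas nab_simps =
  bilinear_ladd[OF bilinear_nab] bilinear_radd[OF bilinear_nab] bilinear_lmul[OF bilinear_nab]
  bilinear_rmul[OF bilinear_nab] bilinear_lsub[OF bilinear_nab] bilinear_rsub[OF bilinear_nab]
  bilinear_lzero[OF bilinear_nab] bilinear_rzero[OF bilinear_nab]

text \<open>Compatibility of the connection with the metric: in the sum of the two Koszul formulas
  all six terms cancel in pairs by antisymmetry of the bracket.\<close>

lemma nab_metric: "ip (nab X Y) Z = - ip Y (nab X Z)"
proof -
  have "2 * ip (nab X Y) Z + 2 * ip (nab X Z) Y = 0"
    unfolding koszul using br_antisym[of X Y] br_antisym[of Y Z] br_antisym[of X Z]
    by (simp add: bilinear_lneg[OF bilinear_ip] bilinear_rneg[OF bilinear_ip] ip_sym)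
  then show ?thesis using ip_sym[of Y "nab X Z"] by simp
qed

text \<open>In the difference of the two Koszul formulas four terms cancel and the other two agree.
  Absence of torsion is the reason why strong ideals are Lie ideals.\<close>

lemma nab_torsion: "nab X Y - nab Y X = br X Y"
proof (rule ip_eqI[OF subspace_UNIV nondegenerate_ip])
  fix Z
  have "2 * ip (nab X Y) Z - 2 * ip (nab Y X) Z = 2 * ip (br X Y) Z"
    unfolding koszul using br_antisym[of X Y] br_antisym[of Y Z] br_antisym[of X Z]
    by (simp add: ip_simps bilinear_lneg[OF bilinear_ip])
  then show "ip (nab X Y - nab Y X) Z = ip (br X Y) Z" by (simp add: ip_simps)
qed simp_all

lemma strong_ideal_UNIV_iff:
  "strong_ideal br ip UNIV H \<longleftrightarrow> subspace H \<and> (\<forall>X. \<forall>Y\<in>H. nab X Y \<in> H \<and> nab Y X \<in> H)"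
  by (simp add: strong_ideal_iff)

lemma strong_ideal_br:
  assumes "strong_ideal br ip UNIV H" "Y \<in> H"
  shows "br X Y \<in> H" "br Y X \<in> H"
proof -
  have "subspace H" "nab X Y \<in> H" "nab Y X \<in> H"
    using assms unfolding strong_ideal_UNIV_iff by simp_all
  then have "nab X Y - nab Y X \<in> H" "nab Y X - nab X Y \<in> H" by (simp_all add: subspace_diff)
  then show "br X Y \<in> H" "br Y X \<in> H" unfolding nab_torsion .
qed

text \<open>Both sides satisfy the same Koszul equation against every \<open>Z\<close> in
  \<open>H\<close>. The right-hand side lies in \<open>H\<close> because the ideal is strong, so
  non-degeneracy on \<open>H\<close> identifies them.\<close>

lemma levi_civita_strong_ideal:
  assumes H: "strong_ideal br ip UNIV H" "nondegenerate_on H ip" and XY: "X \<in> H" "Y \<in> H"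
  shows "levi_civita br ip H X Y = nab X Y"
proof -
  have sub: "subspace H" using H(1) by (simp add: strong_ideal_def)
  show ?thesis
  proof (rule ip_eqI[OF sub H(2)])
    show "levi_civita br ip H X Y \<in> H" by (rule levi_civita(1)[OF sub H(2)])
    show "nab X Y \<in> H" using H(1) XY by (simp add: strong_ideal_UNIV_iff)
    show "ip (levi_civita br ip H X Y) Z = ip (nab X Y) Z" if "Z \<in> H" for Z
      using levi_civita(2)[OF sub H(2) that, of X Y] koszul[of X Y Z] by simp
  qed
qed

section \<open>Curvature and Ricci tensor, and their restriction to a strong ideal\<close>

lemma linear_curvature: "linear (\<lambda>Z. curvature br ip UNIV Z X Y)"
  unfolding curvature_def
  by (rule linearI) (simp_all add: nab_simps br_simps algebra_simps)

lemma curvature_strong_ideal: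
  assumes H: "strong_ideal br ip UNIV H" "nondegenerate_on H ip" and "X \<in> H" "Y \<in> H" "Z \<in> H"
  shows "curvature br ip H X Y Z = curvature br ip UNIV X Y Z"
proof -
  have "nab A B \<in> H" if "A \<in> H" for A B using H(1) that by (simp add: strong_ideal_UNIV_iff)
  then show ?thesis
    using assms strong_ideal_br[OF H(1)]
    by (simp add: curvature_def levi_civita_strong_ideal)
qed

text \<open>The basis picked in \<open>trace_on\<close> depends on \<open>V\<close> alone and lies
  in \<open>V\<close>, so both traces are sums over the same vectors.\<close>

lemma trace_on_cong:
  assumes "\<And>x. x \<in> V \<Longrightarrow> S x = T x" and "subspace V"
  shows "trace_on V S = trace_on V T"
proof -
  define C where "C = (SOME C. independent C \<and> span C = V)"
  have "\<exists>C. independent C \<and> span C = V"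
    using real_vector.maximal_independent_subset[of V] assms(2)
    by (metis span_minimal subset_antisym)
  then have "span C = V" unfolding C_def by (metis (mono_tags, lifting) someI_ex)
  then have "S b = T b" if "b \<in> C" for b using assms(1) span_base that by blast
  then show ?thesis unfolding trace_on_def C_def[symmetric] Let_def by simp
qed

text \<open>For \<open>Y\<close> in \<open>H\<close> the map sending \<open>Z\<close> to
  \<open>curvature br ip UNIV Z X Y\<close> takes the whole algebra into \<open>H\<close>, so its
  trace can be computed on \<open>H\<close>, where the two curvatures agree.\<close>

lemma ricci_strong_ideal:
  assumes H: "strong_ideal br ip UNIV H" "nondegenerate_on H ip" and XY: "X \<in> H" "Y \<in> H"
  shows "ricci br ip UNIV X Y = ricci br ip H X Y"
proof -
  have sub: "subspace H" using H(1) by (simp add: strong_ideal_def)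
  obtain B :: "'a set" where B: "finite B" "span B = UNIV" using finite_dim by blast
  have "curvature br ip UNIV Z X Y \<in> H" for Z
    using H(1) XY unfolding strong_ideal_UNIV_iff curvature_def by (simp add: subspace_diff)
  then have "ricci br ip UNIV X Y = trace_on H (\<lambda>Z. curvature br ip UNIV Z X Y)"
    unfolding ricci_def by (intro trace_on_range[OF B sub linear_curvature]) blast
  also have "\<dots> = ricci br ip H X Y"
    unfolding ricci_def using curvature_strong_ideal[OF H _ XY]
    by (intro trace_on_cong sub) simp
  finally show ?thesis .
qed

lemma trace_on_UNIV_linear:
  "\<exists>B :: 'a set. independent B \<and> span B = UNIV \<and>
     (\<forall>T. linear T \<longrightarrow> trace_on UNIV T = (\<Sum>b\<in>B. representation B (T b) b))"
proof -
  obtain B0 :: "'a set" where B0: "finite B0" "span B0 = UNIV" using finite_dim by blast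
  obtain B :: "'a set" where B: "independent B" "UNIV \<subseteq> span B"
    by (rule real_vector.maximal_independent_subset[of "UNIV :: 'a set"])
  then have B: "independent B" "span B = UNIV" by auto
  have "finite B" using real_vector.independent_span_bound[OF B0(1) B(1)] B0(2) by simp
  then have "trace_on UNIV T = (\<Sum>b\<in>B. representation B (T b) b)" if "linear T" for T :: "'a \<Rightarrow> 'a"
    using B that by (intro trace_on_eq) (simp_all add: linear_add linear_scale)
  then show ?thesis using B by blast
qed

lemma bilinear_ricci: "bilinear (ricci br ip UNIV)"
proof -
  obtain B :: "'a set" where B: "independent B" "span B = UNIV"
    and tr: "\<forall>T :: 'a \<Rightarrow> 'a. linear T \<longrightarrow> trace_on UNIV T = (\<Sum>b\<in>B. representation B (T b) b)"
    using trace_on_UNIV_linear by blast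
  have r: "ricci br ip UNIV X Y = (\<Sum>b\<in>B. representation B (curvature br ip UNIV b X Y) b)" for X Y
    unfolding ricci_def by (rule tr[rule_format, OF linear_curvature])
  have rep: "representation B (x + y) b = representation B x b + representation B y b"
    "representation B (c *\<^sub>R x) b = c * representation B x b" for x y b c
    using B by (simp_all add: real_vector.representation_add real_vector.representation_scale)
  have cur: "curvature br ip UNIV b (X + X') Y = curvature br ip UNIV b X Y + curvature br ip UNIV b X' Y"
    "curvature br ip UNIV b X (Y + Y') = curvature br ip UNIV b X Y + curvature br ip UNIV b X Y'"
    "curvature br ip UNIV b (c *\<^sub>R X) Y = c *\<^sub>R curvature br ip UNIV b X Y"
    "curvature br ip UNIV b X (c *\<^sub>R Y) = c *\<^sub>R curvature br ip UNIV b X Y" for b X X' Y Y' c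
    by (simp_all add: curvature_def nab_simps br_simps algebra_simps)
  show ?thesis
    unfolding bilinear_def
    by (intro conjI allI linearI) (simp_all add: r cur rep sum.distrib sum_distrib_left)
qed

lemma ricci_eq_0: "(\<And>Z. curvature br ip UNIV Z X Y = 0) \<Longrightarrow> ricci br ip UNIV X Y = 0"
proof -
  assume *: "\<And>Z. curvature br ip UNIV Z X Y = 0"
  obtain B :: "'a set" where B: "independent B" "span B = UNIV"
    and tr: "\<forall>T :: 'a \<Rightarrow> 'a. linear T \<longrightarrow> trace_on UNIV T = (\<Sum>b\<in>B. representation B (T b) b)"
    using trace_on_UNIV_linear by blast
  have "ricci br ip UNIV X Y = (\<Sum>b\<in>B. representation B (curvature br ip UNIV b X Y) b)"
    unfolding ricci_def by (rule tr[rule_format, OF linear_curvature])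
  also have "\<dots> = 0" by (simp add: * real_vector.representation_zero)
  finally show ?thesis .
qed

text \<open>A proper subspace is annihilated by a functional \<open>f\<close> with
  \<open>f v = 1\<close> for some \<open>v\<close> outside it. Representing \<open>f\<close> by the
  form gives a non-zero vector orthogonal to \<open>V\<close>; this works also when the form is
  degenerate on \<open>V\<close>.\<close>

lemma subspace_eq_UNIV:
  assumes V: "subspace V" and perp: "\<And>w. (\<And>z. z \<in> V \<Longrightarrow> ip w z = 0) \<Longrightarrow> w = 0"
  shows "V = UNIV"
proof (rule ccontr)
  assume "V \<noteq> UNIV"
  then obtain v where v: "v \<notin> V" by blast
  obtain C where C: "independent C" "span C = V"
    using real_vector.maximal_independent_subset[of V] V by (metis span_minimal subset_antisym)
  then have ind: "independent (insert v C)" using v by (simp add: independent_insertI)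
  obtain f :: "'a \<Rightarrow> real" where f: "linear f" "\<forall>x\<in>insert v C. f x = (if x = v then 1 else 0)"
    using linear_independent_extend[OF ind, of "\<lambda>x. if x = v then 1 else 0"] by blast
  have vC: "v \<notin> C" using v C(2) span_base by blast
  have fV: "f z = 0" if "z \<in> V" for z
  proof -
    have "f x = 0" if "x \<in> C" for x using f(2) that vC by auto
    moreover have "z \<in> span C" using that C(2) by simp
    ultimately show ?thesis by (rule linear_eq_0_on_span[OF f(1)])
  qed
  obtain w where "\<forall>z. ip w z = f z"
    using riesz[OF subspace_UNIV nondegenerate_ip f(1)] by auto
  moreover have "w = 0" using perp fV calculation by metis
  ultimately show False using f(2) by (simp add: ip_simps)
qed

subsection \<open>Complementary strong ideals\<close>

lemma nab_complement:
  assumes "strong_ideal br ip UNIV H" "strong_ideal br ip UNIV K" and "is_direct_sum UNIV [H, K]"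
    and "X \<in> H" "Y \<in> K"
  shows "nab X Y = 0" "nab Y X = 0"
proof -
  have "nab X Y \<in> H \<inter> K" "nab Y X \<in> H \<inter> K"
    using assms(1,2,4,5) unfolding strong_ideal_UNIV_iff by simp_all
  then show "nab X Y = 0" "nab Y X = 0"
    using assms(3) unfolding is_direct_sum_pair_iff by simp_all
qed

text \<open>Each of the three curvature terms is a product of an element of \<open>H\<close> with an
  element of \<open>K\<close>, or a derivative of such a product.\<close>

lemma ricci_complement:
  assumes H: "strong_ideal br ip UNIV H" and K: "strong_ideal br ip UNIV K"
    and HK: "is_direct_sum UNIV [H, K]" and XY: "X \<in> H" "Y \<in> K"
  shows "ricci br ip UNIV X Y = 0"
proof (rule ricci_eq_0)
  fix Z
  have "nab Z Y \<in> K" using K XY(2) by (simp add: strong_ideal_UNIV_iff)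
  moreover have "br Z X \<in> H" by (rule strong_ideal_br(1)[OF H XY(1)])
  ultimately show "curvature br ip UNIV Z X Y = 0"
    using nab_complement(1)[OF H K HK] XY by (simp add: curvature_def nab_simps)
qed

lemma strong_ideal_restrict:
  assumes G: "strong_ideal br ip UNIV G" "nondegenerate_on G ip"
    and M: "strong_ideal br ip UNIV M" "M \<subseteq> G"
  shows "strong_ideal br ip G M"
  unfolding strong_ideal_iff
proof (intro conjI ballI)
  show "subspace M" using M(1) by (simp add: strong_ideal_def)
  fix X Y assume XY: "X \<in> G" "Y \<in> M"
  then have "Y \<in> G" using M(2) by blast
  then show "levi_civita br ip G X Y \<in> M" "levi_civita br ip G Y X \<in> M"
    using XY M(1) by (simp_all add: levi_civita_strong_ideal[OF G] strong_ideal_UNIV_iff)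
qed (rule M(2))

text \<open>The complement \<open>K\<close> is what makes the relation transitive: in a product with
  an element of \<open>A\<close> the \<open>K\<close>-component of the other vector contributes
  zero, and the remaining product is that of \<open>H\<close>.\<close>

lemma strong_ideal_trans:
  assumes H: "strong_ideal br ip UNIV H" "nondegenerate_on H ip" and K: "strong_ideal br ip UNIV K"
    and HK: "is_direct_sum UNIV [H, K]" and A: "strong_ideal br ip H A"
  shows "strong_ideal br ip UNIV A"
  unfolding strong_ideal_UNIV_iff
proof (intro conjI allI ballI)
  show "subspace A" using A by (simp add: strong_ideal_def)
  fix X Y assume Y: "Y \<in> A"
  then have YH: "Y \<in> H" using A by (auto simp: strong_ideal_iff)
  obtain a b where X: "a \<in> H" "b \<in> K" "X = a + b"
    using HK unfolding is_direct_sum_pair_iff by blast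
  then have "nab X Y = levi_civita br ip H a Y" "nab Y X = levi_civita br ip H Y a"
    using nab_complement[OF H(1) K HK YH X(2)]
    by (simp_all add: nab_simps levi_civita_strong_ideal[OF H] YH)
  then show "nab X Y \<in> A" "nab Y X \<in> A" using A X(1) Y by (simp_all add: strong_ideal_iff)
qed

text \<open>The sum of all factors except the one at position \<open>i\<close>. Functions that
  vanish at \<open>i\<close> keep the index set of the full list, so the uniqueness of components
  applies without renumbering.\<close>

definition other_factors :: "'a set list \<Rightarrow> nat \<Rightarrow> 'a set" where
  "other_factors Hs i = {\<Sum>k<length Hs. f k | f. (\<forall>k<length Hs. f k \<in> Hs ! k) \<and> f i = 0}"

lemma other_factorsI:
  "(\<And>k. k < length Hs \<Longrightarrow> f k \<in> Hs ! k) \<Longrightarrow> f i = 0 \<Longrightarrow> (\<Sum>k<length Hs. f k) \<in> other_factors Hs i"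
  unfolding other_factors_def by blast

lemma other_factorsE:
  assumes "x \<in> other_factors Hs i"
  obtains f where "\<forall>k<length Hs. f k \<in> Hs ! k" "f i = 0" "x = (\<Sum>k<length Hs. f k)"
  using assms unfolding other_factors_def by blast

lemma nth_subset_other_factors:
  assumes ds: "is_direct_sum UNIV Hs" and ij: "j < length Hs" "i \<noteq> j"
  shows "Hs ! j \<subseteq> other_factors Hs i"
proof
  fix x assume "x \<in> Hs ! j"
  then have "(\<Sum>k<length Hs. if k = j then x else 0) \<in> other_factors Hs i"
    using ij is_direct_sum_subspace[OF ds] by (intro other_factorsI) (auto simp: subspace_0)
  then show "x \<in> other_factors Hs i" using ij(1) by simp
qed

lemma sum_minus_nth_mem_other_factors:
  assumes ds: "is_direct_sum UNIV Hs" and i: "i < length Hs"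
    and f: "\<And>k. k < length Hs \<Longrightarrow> f k \<in> Hs ! k"
  shows "(\<Sum>k<length Hs. f k) - f i \<in> other_factors Hs i"
proof -
  let ?g = "\<lambda>k. if k = i then 0 else f k"
  have "(\<Sum>k<length Hs. f k) - f i = (\<Sum>k<length Hs. f k) - (\<Sum>k<length Hs. if k = i then f i else 0)"
    using i by simp
  also have "\<dots> = (\<Sum>k<length Hs. ?g k)"
    unfolding sum_subtractf[symmetric] by (intro sum.cong) auto
  also have "\<dots> \<in> other_factors Hs i"
    using f is_direct_sum_subspace[OF ds] by (intro other_factorsI) (auto simp: subspace_0)
  finally show ?thesis .
qed

lemma is_direct_sum_other_factors:
  assumes ds: "is_direct_sum UNIV Hs" and i: "i < length Hs"
  shows "is_direct_sum UNIV [Hs ! i, other_factors Hs i]"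
  unfolding is_direct_sum_pair_iff
proof (intro conjI ballI)
  note sub = is_direct_sum_subspace[OF ds]
  show "subspace (Hs ! i)" by (rule sub[OF i])
  show sub': "subspace (other_factors Hs i)"
  proof (rule subspaceI)
    have "(\<Sum>k<length Hs. 0) \<in> other_factors Hs i"
      using sub by (intro other_factorsI) (simp_all add: subspace_0)
    then show "0 \<in> other_factors Hs i" by simp
  next
    fix x y assume "x \<in> other_factors Hs i" "y \<in> other_factors Hs i"
    then obtain f g where f: "\<forall>k<length Hs. f k \<in> Hs ! k" "f i = 0" "x = (\<Sum>k<length Hs. f k)"
      and g: "\<forall>k<length Hs. g k \<in> Hs ! k" "g i = 0" "y = (\<Sum>k<length Hs. g k)"
      by (elim other_factorsE)
    then have "x + y = (\<Sum>k<length Hs. f k + g k)" by (simp add: sum.distrib)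
    also have "\<dots> \<in> other_factors Hs i"
      using f g sub by (intro other_factorsI) (simp_all add: subspace_add)
    finally show "x + y \<in> other_factors Hs i" .
  next
    fix c x assume "x \<in> other_factors Hs i"
    then obtain f where f: "\<forall>k<length Hs. f k \<in> Hs ! k" "f i = 0" "x = (\<Sum>k<length Hs. f k)"
      by (elim other_factorsE)
    then have "c *\<^sub>R x = (\<Sum>k<length Hs. c *\<^sub>R f k)" by (simp add: scaleR_sum_right)
    also have "\<dots> \<in> other_factors Hs i"
      using f sub by (intro other_factorsI) (simp_all add: subspace_scale)
    finally show "c *\<^sub>R x \<in> other_factors Hs i" .
  qed
  have "x = 0" if x: "x \<in> Hs ! i" "x \<in> other_factors Hs i" for x
  proof -
    obtain f where f: "\<forall>k<length Hs. f k \<in> Hs ! k" "f i = 0" "x = (\<Sum>k<length Hs. f k)"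
      using x(2) by (elim other_factorsE)
    let ?g = "\<lambda>k. f k - (if k = i then x else 0)"
    have "?g k \<in> Hs ! k" if "k < length Hs" for k
      using f(1) that x(1) sub[OF that] by (cases "k = i") (simp_all add: subspace_diff)
    moreover have "(\<Sum>k<length Hs. ?g k) = 0" using i f(3) by (simp add: sum_subtractf)
    ultimately have "?g i = 0" using is_direct_sum_zero[OF ds, of ?g i] i by blast
    then show ?thesis using f(2) by simp
  qed
  then show "Hs ! i \<inter> other_factors Hs i = {0}"
    using sub[OF i] sub' by (auto simp: subspace_0)
  show "\<exists>a\<in>Hs ! i. \<exists>b\<in>other_factors Hs i. x = a + b" for x
  proof -
    obtain f where f: "\<And>k. k < length Hs \<Longrightarrow> f k \<in> Hs ! k" "x = (\<Sum>k<length Hs. f k)"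
      using is_direct_sum_obtain[OF ds UNIV_I] by metis
    then have "x - f i \<in> other_factors Hs i"
      using sum_minus_nth_mem_other_factors[OF ds i] by simp
    then show ?thesis using f(1)[OF i] by (intro bexI[of _ "f i"] bexI[of _ "x - f i"]) simp_all
  qed
qed simp_all

lemma strong_ideal_other_factors:
  assumes ds: "is_direct_sum UNIV Hs" and i: "i < length Hs"
    and strong: "\<And>H. H \<in> set Hs \<Longrightarrow> strong_ideal br ip UNIV H"
  shows "strong_ideal br ip UNIV (other_factors Hs i)"
  unfolding strong_ideal_UNIV_iff
proof (intro conjI allI ballI)
  show "subspace (other_factors Hs i)"
    using is_direct_sum_other_factors[OF ds i] by (simp add: is_direct_sum_pair_iff)
  fix X Y assume "Y \<in> other_factors Hs i"
  then obtain f where f: "\<forall>k<length Hs. f k \<in> Hs ! k" "f i = 0" "Y = (\<Sum>k<length Hs. f k)"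
    by (elim other_factorsE)
  have mem: "nab X (f k) \<in> Hs ! k" "nab (f k) X \<in> Hs ! k" if "k < length Hs" for k
    using strong[of "Hs ! k"] f(1) that by (simp_all add: strong_ideal_UNIV_iff)
  have lin: "linear (nab X)" "linear (\<lambda>Y. nab Y X)" using bilinear_nab by (simp_all add: bilinear_def)
  have "nab X Y = (\<Sum>k<length Hs. nab X (f k))" "nab Y X = (\<Sum>k<length Hs. nab (f k) X)"
    unfolding f(3) by (rule linear_sum[OF lin(1)], rule linear_sum[OF lin(2)])
  moreover have "(\<Sum>k<length Hs. nab X (f k)) \<in> other_factors Hs i"
    "(\<Sum>k<length Hs. nab (f k) X) \<in> other_factors Hs i"
    using mem f(2) by (auto intro!: other_factorsI simp: nab_simps)
  ultimately show "nab X Y \<in> other_factors Hs i" "nab Y X \<in> other_factors Hs i" by simp_all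
qed

subsection \<open>Existence of a decomposition\<close>

lemma indecomposable_decomposition_exists: "\<exists>gs. indecomposable_decomposition br ip gs"
proof -
  define P where "P gs \<longleftrightarrow> is_direct_sum UNIV gs \<and>
    (\<forall>H\<in>set gs. H \<noteq> {0} \<and> strong_ideal br ip UNIV H \<and> nondegenerate_on H ip)" for gs :: "'a set list"
  obtain B :: "'a set" where B: "finite B" "span B = UNIV" using finite_dim by blast
  \<comment> \<open>The zero algebra needs the empty list, since \<open>[UNIV]\<close> would contain
    the forbidden factor \<open>{0}\<close>.\<close>
  have "\<exists>gs. P gs"
  proof (cases "(UNIV :: 'a set) = {0}")
    case True
    then have "P []" by (auto simp: P_def is_direct_sum_iff)
    then show ?thesis ..
  next
    case False
    have "is_direct_sum UNIV [UNIV :: 'a set]"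
      by (auto simp: is_direct_sum_iff intro!: exI[of _ "\<lambda>_. x" for x])
    then have "P [UNIV]"
      using False nondegenerate_ip by (simp add: P_def strong_ideal_UNIV_iff)
    then show ?thesis ..
  qed
  then obtain gs0 where "P gs0" by blast
  moreover have "\<forall>gs. P gs \<longrightarrow> length gs < Suc (card B)"
    using is_direct_sum_length_bound[OF _ B] by (auto simp: P_def less_Suc_eq_le)
  ultimately obtain gs where gs: "P gs" and max: "\<forall>hs. P hs \<longrightarrow> length hs \<le> length gs"
    using ex_has_greatest_nat[of P gs0 length "Suc (card B)"] by metis
  have ds: "is_direct_sum UNIV gs" and strong: "\<And>H. H \<in> set gs \<Longrightarrow> strong_ideal br ip UNIV H"
    and nd: "\<And>H. H \<in> set gs \<Longrightarrow> nondegenerate_on H ip" and nz: "\<And>H. H \<in> set gs \<Longrightarrow> H \<noteq> {0}"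
    using gs by (simp_all add: P_def)
  have "\<not> decomposable br ip H" if H: "H \<in> set gs" for H
  proof
    assume "decomposable br ip H"
    then obtain A C where AC: "is_direct_sum H [A, C]"
      and A: "A \<noteq> {0}" "strong_ideal br ip H A" "nondegenerate_on A ip"
      and C: "C \<noteq> {0}" "strong_ideal br ip H C" "nondegenerate_on C ip"
      unfolding decomposable_def by blast
    obtain i where i: "i < length gs" "gs ! i = H" using H by (auto simp: in_set_conv_nth)
    \<comment> \<open>The parts \<open>A\<close> and \<open>C\<close> are strong ideals of the
      factor \<open>H\<close> only; the complement of \<open>H\<close> formed by the other factors
      makes them strong ideals of the whole algebra.\<close>
    note trans = strong_ideal_trans[OF strong[OF H] nd[OF H]
        strong_ideal_other_factors[OF ds i(1) strong]
        is_direct_sum_other_factors[OF ds i(1), unfolded i(2)]]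
    have "is_direct_sum UNIV (A # gs[i := C])"
      using is_direct_sum_refine[OF ds i(1)] AC i(2) by simp
    moreover have "set (gs[i := C]) \<subseteq> insert C (set gs)" by (rule set_update_subset_insert)
    ultimately have "P (A # gs[i := C])"
      using trans[OF _ A(2)] trans[OF _ C(2)] A C strong nd nz by (auto simp: P_def)
    with max show False by fastforce
  qed
  then show ?thesis
    using ds strong nd nz unfolding indecomposable_decomposition_def by blast
qed

end

subsection \<open>Consequences of a non-degenerate Ricci tensor\<close>

locale ricci_nondegenerate = metric_lie_algebra +
  assumes nondegenerate_ricci: "nondegenerate_on UNIV (ricci br ip UNIV)"
begin

text \<open>Moves the non-degeneracy from the first argument to the second, in place of an appeal to
  symmetry. Write the Ricci tensor as \<open>ip (A x) z\<close>: the hypothesis makes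
  \<open>A\<close> injective, finite dimension makes it surjective, and so \<open>Y\<close> is
  orthogonal to every vector.\<close>

lemma ricci_right_kernel:
  assumes "\<And>X. ricci br ip UNIV X Y = 0"
  shows "Y = 0"
proof -
  have "\<exists>!w. w \<in> UNIV \<and> (\<forall>z\<in>UNIV. ip w z = ricci br ip UNIV x z)" for x
    using bilinear_ricci by (intro riesz subspace_UNIV nondegenerate_ip) (simp add: bilinear_def)
  then have "\<forall>x. \<exists>w. \<forall>z. ip w z = ricci br ip UNIV x z" by (meson UNIV_I)
  then obtain A where A: "\<And>x z. ip (A x) z = ricci br ip UNIV x z" by metis
  have lin: "linear A"
    by (rule linearI; rule ip_eqI[OF subspace_UNIV nondegenerate_ip])
      (simp_all add: A ip_simps bilinear_ladd[OF bilinear_ricci] bilinear_lmul[OF bilinear_ricci])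
  have "x = 0" if "A x = 0" for x
  proof -
    have "\<forall>z. ricci br ip UNIV x z = 0" using A[of x] that by (simp add: ip_simps)
    then show ?thesis using nondegenerate_ricci by (simp add: nondegenerate_on_def)
  qed
  then have inj: "inj A" using linear_injective_0[OF lin] by blast
  obtain B where B: "independent B" "span B = (UNIV :: 'a set)" using trace_on_UNIV_linear by blast
  have "surj A"
  proof -
    obtain B0 :: "'a set" where B0: "finite B0" "span B0 = UNIV" using finite_dim by blast
    have "finite B" using real_vector.independent_span_bound[OF B0(1) B(1)] B0(2) by simp
    \<comment> \<open>The type is only a real vector space, so the finite-dimensional theory is
      instantiated with the basis \<open>B\<close>.\<close>
    then interpret fd: finite_dimensional_vector_space "scaleR :: real \<Rightarrow> 'a \<Rightarrow> 'a" B
      using B by unfold_locales (simp_all add: dependent_raw_def span_raw_def)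
    show ?thesis
      using fd.linear_inj_imp_surj[OF _ inj] lin by (simp add: linear_def)
  qed
  then have "ip w Y = 0" for w using A[of _ Y] assms by (metis surjD)
  then have "ip Y w = 0" for w using ip_sym by metis
  then show ?thesis using nondegenerate_ip by (simp add: nondegenerate_on_def)
qed

text \<open>Every term of \<open>curvature br ip UNIV Z X Y\<close> begins by differentiating
  \<open>Y\<close>, so the curvature and its trace vanish.\<close>

lemma parallel_eq_0:
  assumes "\<And>Z. nab Z Y = 0"
  shows "Y = 0"
proof (rule ricci_right_kernel)
  show "ricci br ip UNIV X Y = 0" for X
    by (rule ricci_eq_0) (simp add: curvature_def assms nab_simps)
qed

lemma span_nab_UNIV: "span (range (\<lambda>(X, Y). nab X Y)) = UNIV"
proof (rule subspace_eq_UNIV[OF subspace_span])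
  fix w assume *: "\<And>z. z \<in> span (range (\<lambda>(X, Y). nab X Y)) \<Longrightarrow> ip w z = 0"
  have "nab X w = 0" for X
  proof (rule ip_eqI[OF subspace_UNIV nondegenerate_ip])
    fix Y
    have "nab X Y \<in> range (\<lambda>(X, Y). nab X Y)" by (rule range_eqI[of _ _ "(X, Y)"]) simp
    then have "ip w (nab X Y) = 0" by (intro * span_base)
    then show "ip (nab X w) Y = ip 0 Y" by (simp add: nab_metric ip_simps)
  qed simp_all
  then show "w = 0" by (rule parallel_eq_0)
qed

lemma span_nab_strong_ideal:
  assumes H: "strong_ideal br ip UNIV H" and K: "strong_ideal br ip UNIV K"
    and HK: "is_direct_sum UNIV [H, K]" and X: "X \<in> H"
  shows "X \<in> span {nab a b | a b. a \<in> H \<and> b \<in> H}"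
proof -
  let ?S = "\<lambda>H. {nab a b | a b. a \<in> H \<and> b \<in> H}"
  have sub: "subspace H" "subspace K" and int: "H \<inter> K = {0}"
    and sum: "\<And>x. \<exists>a\<in>H. \<exists>b\<in>K. x = a + b"
    using HK unfolding is_direct_sum_pair_iff by simp_all
  have "nab x y \<in> span (?S H \<union> ?S K)" for x y
  proof -
    obtain a b c d where *: "a \<in> H" "b \<in> K" "x = a + b" "c \<in> H" "d \<in> K" "y = c + d"
      using sum[of x] sum[of y] by blast
    then have "nab x y = nab a c + nab b d"
      using nab_complement[OF H K HK] by (simp add: nab_simps)
    moreover have "nab a c \<in> ?S H" "nab b d \<in> ?S K" using * by blast+
    ultimately show ?thesis by (simp add: span_add span_base)
  qed
  then have "span (range (\<lambda>(X, Y). nab X Y)) \<subseteq> span (?S H \<union> ?S K)"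
    by (intro span_minimal subspace_span) auto
  then have "X \<in> span (?S H \<union> ?S K)" unfolding span_nab_UNIV by blast
  \<comment> \<open>The products inside \<open>K\<close> may not contribute: \<open>t\<close> lies
    in \<open>K\<close>, and also in \<open>H\<close> as the difference of \<open>X\<close> and
    \<open>s\<close>.\<close>
  then obtain s t where st: "s \<in> span (?S H)" "t \<in> span (?S K)" "X = s + t"
    unfolding span_Un by blast
  have "?S H \<subseteq> H" "?S K \<subseteq> K" using H K by (auto simp: strong_ideal_UNIV_iff)
  then have "s \<in> H" "t \<in> K" using st(1,2) sub by (meson span_minimal subsetD)+
  moreover have "t = X - s" using st(3) by simp
  ultimately have "t \<in> H \<inter> K" using X sub by (simp add: subspace_diff)
  then have "t = 0" using int by simp
  then show ?thesis using st by simp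
qed

text \<open>By skew-symmetry \<open>ip (nab a b) Y\<close> is minus \<open>ip b (nab a Y)\<close>,
  and \<open>nab a Y\<close> is a mixed product, hence zero; the vectors \<open>nab a b\<close> span
  \<open>H\<close>.\<close>

lemma ip_complement:
  assumes H: "strong_ideal br ip UNIV H" and K: "strong_ideal br ip UNIV K"
    and HK: "is_direct_sum UNIV [H, K]" and XY: "X \<in> H" "Y \<in> K"
  shows "ip X Y = 0"
proof -
  have "subspace {x. ip x Y = 0}" by (rule subspaceI) (simp_all add: ip_simps)
  moreover have "{nab a b | a b. a \<in> H \<and> b \<in> H} \<subseteq> {x. ip x Y = 0}"
    using nab_complement(1)[OF H K HK _ XY(2)] by (auto simp: nab_metric ip_simps)
  ultimately have "span {nab a b | a b. a \<in> H \<and> b \<in> H} \<subseteq> {x. ip x Y = 0}"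
    by (intro span_minimal)
  then show ?thesis using span_nab_strong_ideal[OF H K HK XY(1)] by blast
qed

lemma nondegenerate_ricci_complement:
  assumes H: "strong_ideal br ip UNIV H" and K: "strong_ideal br ip UNIV K"
    and HK: "is_direct_sum UNIV [H, K]"
  shows "nondegenerate_on H (ricci br ip UNIV)"
  unfolding nondegenerate_on_def
proof (intro ballI impI)
  fix X assume X: "X \<in> H" "\<forall>Y\<in>H. ricci br ip UNIV X Y = 0"
  have "ricci br ip UNIV X Y = 0" for Y
  proof -
    obtain a b where "a \<in> H" "b \<in> K" "Y = a + b"
      using HK unfolding is_direct_sum_pair_iff by blast
    then show ?thesis
      using X(2) ricci_complement[OF H K HK X(1)] by (simp add: bilinear_radd[OF bilinear_ricci])
  qed
  then show "X = 0" using nondegenerate_ricci by (simp add: nondegenerate_on_def)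
qed

subsection \<open>Uniqueness of the decomposition\<close>

lemma strong_ideal_split:
  assumes H: "strong_ideal br ip UNIV H" and K: "strong_ideal br ip UNIV K"
    and HK: "is_direct_sum UNIV [H, K]"
    and G: "strong_ideal br ip UNIV G" and L: "strong_ideal br ip UNIV L"
    and GL: "is_direct_sum UNIV [G, L]" and X: "X \<in> G"
  shows "\<exists>a\<in>G \<inter> H. \<exists>b\<in>G \<inter> K. X = a + b"
proof -
  have sum: "\<exists>a\<in>H. \<exists>b\<in>K. x = a + b" for x
    using HK unfolding is_direct_sum_pair_iff by simp
  have sub: "subspace (G \<inter> H)" "subspace (G \<inter> K)"
    using G H K by (auto simp: strong_ideal_def intro: subspace_inter)
  have "nab x y \<in> span (G \<inter> H \<union> G \<inter> K)" if xy: "x \<in> G" "y \<in> G" for x y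
  proof -
    obtain a b c d where *: "a \<in> H" "b \<in> K" "x = a + b" "c \<in> H" "d \<in> K" "y = c + d"
      using sum[of x] sum[of y] by blast
    \<comment> \<open>The components \<open>a\<close> and \<open>c\<close> need not lie in
      \<open>G\<close>. Since \<open>nab a d\<close> vanishes, \<open>c\<close> may be replaced by
      \<open>y\<close>, which does lie in \<open>G\<close>; so the product is in \<open>G\<close> as
      well as in \<open>H\<close>.\<close>
    have "nab a c = nab a y" "nab b d = nab b y"
      using * nab_complement[OF H K HK] by (simp_all add: nab_simps)
    then have "nab a c \<in> G \<inter> H" "nab b d \<in> G \<inter> K"
      using * xy(2) G H K by (auto simp: strong_ideal_UNIV_iff)
    moreover have "nab x y = nab a c + nab b d"
      using * nab_complement[OF H K HK] by (simp add: nab_simps)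
    ultimately show ?thesis by (simp add: span_add span_base)
  qed
  then have "span {nab x y | x y. x \<in> G \<and> y \<in> G} \<subseteq> span (G \<inter> H \<union> G \<inter> K)"
    by (intro span_minimal subspace_span) auto
  then have "X \<in> span (G \<inter> H \<union> G \<inter> K)" using span_nab_strong_ideal[OF G L GL X] by blast
  moreover have "span (G \<inter> H) = G \<inter> H" "span (G \<inter> K) = G \<inter> K" using sub by (simp_all only: span_eq_iff)
  ultimately show ?thesis unfolding span_Un by auto
qed

lemma indecomposable_subset:
  assumes H: "strong_ideal br ip UNIV H" and K: "strong_ideal br ip UNIV K"
    and HK: "is_direct_sum UNIV [H, K]"
    and G: "strong_ideal br ip UNIV G" "nondegenerate_on G ip" "\<not> decomposable br ip G"
    and L: "strong_ideal br ip UNIV L" and GL: "is_direct_sum UNIV [G, L]"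
  shows "G \<subseteq> H \<or> G \<subseteq> K"
proof -
  note split = strong_ideal_split[OF H K HK G(1) L GL]
  have strong: "strong_ideal br ip UNIV (G \<inter> M)" if "strong_ideal br ip UNIV M" for M
    using G(1) that by (auto simp: strong_ideal_UNIV_iff intro: subspace_inter)
  have HK0: "H \<inter> K = {0}" using HK by (simp add: is_direct_sum_pair_iff)
  have zero: "0 \<in> G" "0 \<in> H" "0 \<in> K" using G H K by (auto simp: strong_ideal_def subspace_0)
  have ds: "is_direct_sum G [G \<inter> H, G \<inter> K]"
    unfolding is_direct_sum_pair_iff
    using strong[OF H] strong[OF K] HK0 zero split by (auto simp: strong_ideal_def)
  \<comment> \<open>A vector of \<open>G \<inter> H\<close> is orthogonal to
    \<open>G \<inter> K\<close> in any case. If it is orthogonal to \<open>G \<inter> H\<close> too,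
    it is orthogonal to all of \<open>G\<close>, on which the form is non-degenerate.\<close>
  have nd: "nondegenerate_on (G \<inter> H) ip"
    unfolding nondegenerate_on_def
  proof (intro ballI impI)
    fix x assume x: "x \<in> G \<inter> H" "\<forall>y\<in>G \<inter> H. ip x y = 0"
    have "ip x y = 0" if "y \<in> G" for y
      using split[OF that] x ip_complement[OF H K HK] by (auto simp: ip_simps)
    then show "x = 0" using x(1) G(2) by (auto simp: nondegenerate_on_def)
  qed
  have nd': "nondegenerate_on (G \<inter> K) ip"
    unfolding nondegenerate_on_def
  proof (intro ballI impI)
    fix x assume x: "x \<in> G \<inter> K" "\<forall>y\<in>G \<inter> K. ip x y = 0"
    have "ip x y = 0" if "y \<in> G" for y
      using split[OF that] x ip_complement[OF H K HK] ip_sym[of x] by (auto simp: ip_simps)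
    then show "x = 0" using x(1) G(2) by (auto simp: nondegenerate_on_def)
  qed
  have "G \<inter> H = {0} \<or> G \<inter> K = {0}"
  proof (rule ccontr)
    assume "\<not> ?thesis"
    moreover have "strong_ideal br ip G (G \<inter> H)" "strong_ideal br ip G (G \<inter> K)"
      using strong_ideal_restrict[OF G(1,2) strong] H K by blast+
    ultimately have "decomposable br ip G" unfolding decomposable_def using ds nd nd' by blast
    then show False using G(3) by blast
  qed
  then show ?thesis using split by fastforce
qed

text \<open>The alternative for two complementary ideals is applied to one factor and the sum of the
  others. The index \<open>i\<close> is chosen so that some vector of \<open>G\<close> has a
  non-zero component there, which excludes that \<open>G\<close> lies in the other factors.\<close>

lemma indecomposable_subset_nth:
  assumes gs: "indecomposable_decomposition br ip gs"
    and G: "strong_ideal br ip UNIV G" "nondegenerate_on G ip" "\<not> decomposable br ip G" "G \<noteq> {0}"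
    and L: "strong_ideal br ip UNIV L" and GL: "is_direct_sum UNIV [G, L]"
  shows "\<exists>i<length gs. G \<subseteq> gs ! i"
proof -
  have ds: "is_direct_sum UNIV gs" and strong: "\<And>H. H \<in> set gs \<Longrightarrow> strong_ideal br ip UNIV H"
    using gs by (simp_all add: indecomposable_decomposition_def)
  have "0 \<in> G" using G(1) by (simp add: strong_ideal_def subspace_0)
  then obtain x where x: "x \<in> G" "x \<noteq> 0" using G(4) by blast
  obtain f where f: "\<And>k. k < length gs \<Longrightarrow> f k \<in> gs ! k" "x = (\<Sum>k<length gs. f k)"
    using is_direct_sum_obtain[OF ds UNIV_I] by metis
  obtain i where i: "i < length gs" "f i \<noteq> 0"
    using x(2) f(2) by (metis lessThan_iff sum.neutral)
  note other = is_direct_sum_other_factors[OF ds i(1)]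
  have "\<not> G \<subseteq> other_factors gs i"
  proof
    assume "G \<subseteq> other_factors gs i"
    then have "x \<in> other_factors gs i" using x(1) by blast
    moreover have "x - f i \<in> other_factors gs i"
      using sum_minus_nth_mem_other_factors[OF ds i(1) f(1)] f(2) by simp
    moreover have "subspace (other_factors gs i)" using other by (simp add: is_direct_sum_pair_iff)
    ultimately have "x - (x - f i) \<in> other_factors gs i" by (metis subspace_diff)
    then have "f i \<in> gs ! i \<inter> other_factors gs i" using f(1)[OF i(1)] by simp
    moreover have "gs ! i \<inter> other_factors gs i = {0}" using other by (simp add: is_direct_sum_pair_iff)
    ultimately show False using i(2) by blast
  qed
  then show ?thesis
    using indecomposable_subset[OF strong strong_ideal_other_factors[OF ds i(1) strong] other G(1-3) L GL] i(1)
    by auto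
qed

text \<open>Inclusions in both directions give
  \<open>hs ! j \<subseteq> gs ! i \<subseteq> hs ! k\<close>. Distinct factors meet only in zero,
  so \<open>k = j\<close> and the chain collapses to equality.\<close>

lemma indecomposable_decomposition_set_subset:
  assumes gs: "indecomposable_decomposition br ip gs" and hs: "indecomposable_decomposition br ip hs"
  shows "set hs \<subseteq> set gs"
proof
  fix G assume "G \<in> set hs"
  then obtain j where j: "j < length hs" "G = hs ! j" by (auto simp: in_set_conv_nth)
  have sub: "\<exists>i<length gs. hs ! j \<subseteq> gs ! i"
    if "indecomposable_decomposition br ip gs" "indecomposable_decomposition br ip hs" "j < length hs"
    for gs hs j
  proof -
    have ds: "is_direct_sum UNIV hs" and strong: "\<And>H. H \<in> set hs \<Longrightarrow> strong_ideal br ip UNIV H"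
      using that(2) by (simp_all add: indecomposable_decomposition_def)
    have "hs ! j \<in> set hs" using that(3) by simp
    then show ?thesis
      using that(2) indecomposable_subset_nth[OF that(1) _ _ _ _
          strong_ideal_other_factors[OF ds that(3) strong] is_direct_sum_other_factors[OF ds that(3)]]
      by (simp add: indecomposable_decomposition_def)
  qed
  obtain i where i: "i < length gs" "hs ! j \<subseteq> gs ! i" using sub[OF gs hs j(1)] by blast
  obtain k where k: "k < length hs" "gs ! i \<subseteq> hs ! k" using sub[OF hs gs i(1)] by blast
  have "k = j"
  proof (rule ccontr)
    assume "k \<noteq> j"
    then have "hs ! j \<inter> hs ! k = {0}"
      using hs j(1) k(1) by (intro is_direct_sum_nth_Int) (auto simp: indecomposable_decomposition_def)
    moreover have "hs ! j \<subseteq> hs ! k" using i(2) k(2) by (rule subset_trans)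
    ultimately have "hs ! j = {0}" by blast
    then show False using hs j(1) by (simp add: indecomposable_decomposition_def)
  qed
  then have "G = gs ! i" using i(2) k(2) j(2) by blast
  then show "G \<in> set gs" using i(1) by simp
qed

lemma indecomposable_decomposition_distinct:
  assumes "indecomposable_decomposition br ip gs"
  shows "distinct gs"
  unfolding distinct_conv_nth
proof (intro allI impI)
  fix i j assume ij: "i < length gs" "j < length gs" "i \<noteq> j"
  then have "gs ! i \<inter> gs ! j = {0}"
    using assms by (intro is_direct_sum_nth_Int) (auto simp: indecomposable_decomposition_def)
  moreover have "gs ! i \<noteq> {0}" using assms ij(1) by (simp add: indecomposable_decomposition_def)
  ultimately show "gs ! i \<noteq> gs ! j" by auto
qed

text \<open>Non-zero factors with trivial intersections cannot repeat, so equality of the sets of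
  factors already gives equality up to order.\<close>

lemma indecomposable_decomposition_mset_eq:
  assumes "indecomposable_decomposition br ip gs" "indecomposable_decomposition br ip hs"
  shows "mset hs = mset gs"
  using assms indecomposable_decomposition_set_subset indecomposable_decomposition_distinct
  by (subst set_eq_iff_mset_eq_distinct[symmetric]) blast+

end

theorem theorem4p2:
  fixes br :: "'a::real_vector \<Rightarrow> 'a \<Rightarrow> 'a"
    and ip :: "'a \<Rightarrow> 'a \<Rightarrow> real"
  assumes "metric_lie_algebra br ip"
    and "nondegenerate_on UNIV (ricci br ip UNIV)"
  shows "\<exists>gs. indecomposable_decomposition br ip gs \<and>
    (\<forall>gs'. indecomposable_decomposition br ip gs' \<longrightarrow> mset gs' = mset gs) \<and>
    (\<forall>i<length gs. \<forall>j<length gs. i \<noteq> j \<longrightarrow>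
      (\<forall>X\<in>gs ! i. \<forall>Y\<in>gs ! j. ip X Y = 0 \<and> ricci br ip UNIV X Y = 0)) \<and>
    (\<forall>H\<in>set gs.
      (\<forall>X\<in>H. \<forall>Y\<in>H. ricci br ip UNIV X Y = ricci br ip H X Y) \<and>
      nondegenerate_on H (ricci br ip UNIV))"
proof -
  interpret ricci_nondegenerate br ip
    using assms by (simp add: ricci_nondegenerate_def ricci_nondegenerate_axioms_def)
  obtain gs where gs: "indecomposable_decomposition br ip gs"
    using indecomposable_decomposition_exists by blast
  then have ds: "is_direct_sum UNIV gs"
    and strong: "\<And>H. H \<in> set gs \<Longrightarrow> strong_ideal br ip UNIV H"
    and nd: "\<And>H. H \<in> set gs \<Longrightarrow> nondegenerate_on H ip"
    by (simp_all add: indecomposable_decomposition_def)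
  have orth: "ip X Y = 0 \<and> ricci br ip UNIV X Y = 0"
    if ij: "i < length gs" "j < length gs" "i \<noteq> j" and XY: "X \<in> gs ! i" "Y \<in> gs ! j" for i j X Y
  proof -
    have "strong_ideal br ip UNIV (gs ! i)" using strong ij(1) by simp
    moreover note strong_ideal_other_factors[OF ds ij(1) strong] is_direct_sum_other_factors[OF ds ij(1)]
    \<comment> \<open>Orthogonality of two factors follows from that of \<open>gs ! i\<close> and
      its full complement, which contains \<open>gs ! j\<close>.\<close>
    moreover have "Y \<in> other_factors gs i"
      using nth_subset_other_factors[OF ds ij(2,3)] XY(2) by blast
    ultimately show ?thesis using ip_complement ricci_complement XY(1) by blast
  qed
  have factor: "(\<forall>X\<in>H. \<forall>Y\<in>H. ricci br ip UNIV X Y = ricci br ip H X Y) \<and>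
      nondegenerate_on H (ricci br ip UNIV)" if H: "H \<in> set gs" for H
  proof -
    obtain i where i: "i < length gs" "gs ! i = H" using H by (auto simp: in_set_conv_nth)
    then show ?thesis
      using ricci_strong_ideal[OF strong[OF H] nd[OF H]]
        nondegenerate_ricci_complement[OF strong[OF H] strong_ideal_other_factors[OF ds i(1) strong]]
        is_direct_sum_other_factors[OF ds i(1)] by simp
  qed
  show ?thesis
    using gs indecomposable_decomposition_mset_eq[OF gs] orth factor by blast
qed

end
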